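(* Let $G$ be a finite simple graph that has closed isoperimetric nesting. Then $\mathrm{Hun}[G]=1+\max_k\{\mathrm{mun}[k]-k\}$.
   Context: For $S\subseteq V(G)$ let $N[S]=S\cup\{v: v \text{ adjacent to some vertex of } S\}$ (closed neighborhood). $\mathrm{mun}[k]=\min\{|N[W]|: W\subseteq V(G), |W|=k\}$, for $1\le k\le |V(G)|$. Deaf-rabbit game: a hunter strategy is a finite sequence $H=(H_1,\dots,H_m)$ of multisets of vertices; set $R_H(0)=V(G)$ and $R_H(i)=N[R_H(i-1)\setminus H_i]$ (the rabbit may also stay put); $H$ is winning if $R_H(i)=\emptyset$ for some $i$; $\mathrm{Hun}[G]$ is the minimum over winning strategies of $\max_i|H_i|$ (multiplicities counted). With $n=|V(G)|$, $G$ has closed isoperimetric nesting if there is a chain of vertex subsets $G_1,\dots,G_n$ with $|G_i|=i$, $G_i\subset G_{i+1}$, $|N[G_i]|=\mathrm{mun}[i]$, and $N[G_i]=G_{|N[G_i]|}$ for all $i$. *)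

theory Defs
  imports "Graph_Theory.Pair_Digraph" "HOL-Library.Multiset"
begin

text \<open>
  A finite simple graph is an instance of \<^locale>\<open>pair_graph\<close>: finite vertex set, and a
  symmetric irreflexive set of arcs, so that each undirected edge is a pair of opposite arcs.
\<close>

definition closed_nbhd :: "'a pair_pre_digraph \<Rightarrow> 'a set \<Rightarrow> 'a set" where
  "closed_nbhd G S = S \<union> {v. \<exists>u\<in>S. (u, v) \<in> parcs G}"

text \<open>Only meaningful for \<open>k \<le> card (pverts G)\<close>; otherwise the minimum is over the empty set.\<close>

definition mun :: "'a pair_pre_digraph \<Rightarrow> nat \<Rightarrow> nat" where
  "mun G k = Min {card (closed_nbhd G W) | W. W \<subseteq> pverts G \<and> card W = k}"

text \<open>Lists are indexed from \<open>0\<close>, so \<open>H ! i\<close> is the shot multiset of round \<open>i + 1\<close>.\<close>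

primrec rabbit_territory :: "'a pair_pre_digraph \<Rightarrow> 'a multiset list \<Rightarrow> nat \<Rightarrow> 'a set" where
  "rabbit_territory G H 0 = pverts G"
| "rabbit_territory G H (Suc i) = closed_nbhd G (rabbit_territory G H i - set_mset (H ! i))"

definition hunter_strategy :: "'a pair_pre_digraph \<Rightarrow> 'a multiset list \<Rightarrow> bool" where
  "hunter_strategy G H \<longleftrightarrow> (\<forall>M\<in>set H. set_mset M \<subseteq> pverts G)"

definition winning :: "'a pair_pre_digraph \<Rightarrow> 'a multiset list \<Rightarrow> bool" where
  "winning G H \<longleftrightarrow> hunter_strategy G H \<and> (\<exists>i\<le>length H. rabbit_territory G H i = {})"

text \<open>
  If the graph has a vertex, a winning strategy is never the empty list, so the maximum is
  over a nonempty set.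
\<close>

definition Hun :: "'a pair_pre_digraph \<Rightarrow> nat" where
  "Hun G = (LEAST h. \<exists>H. winning G H \<and> h = Max (size ` set H))"

definition closed_isoperimetric_nesting :: "'a pair_pre_digraph \<Rightarrow> bool" where
  "closed_isoperimetric_nesting G \<longleftrightarrow>
     (\<exists>C :: nat \<Rightarrow> 'a set.
        (\<forall>i\<in>{1..card (pverts G)}.
           C i \<subseteq> pverts G \<and> card (C i) = i \<and>
           card (closed_nbhd G (C i)) = mun G i \<and>
           closed_nbhd G (C i) = C (card (closed_nbhd G (C i)))) \<and>
        (\<forall>i\<in>{1..<card (pverts G)}. C i \<subset> C (Suc i)))"

end

theory Submission
  imports Defs
begin

text \<open>
  Let \<open>M\<close> be the largest excess \<open>mun[k] - k\<close>, attained at \<open>k\<close>. With at most \<open>M\<close> shots per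
  round a territory of size at least \<open>mun[k]\<close> keeps at least \<open>k\<close> vertices, whose closed
  neighbourhood again has size at least \<open>mun[k]\<close>; so the rabbit survives. With \<open>M + 1\<close> shots
  the hunter keeps the territory in the nested chain: shooting the top \<open>M + 1\<close> vertices of
  \<open>G\<^sub>j\<close> leaves \<open>G\<^sub>i\<close> with \<open>i = j - M - 1\<close>, and \<open>N[G\<^sub>i]\<close> is a chain member of size
  \<open>mun[i] \<le> i + M < j\<close>.
\<close>

lemma closed_nbhd_empty [simp]: "closed_nbhd G {} = {}"
  by (simp add: closed_nbhd_def)

lemma closed_nbhd_mono: "S \<subseteq> T \<Longrightarrow> closed_nbhd G S \<subseteq> closed_nbhd G T"
  by (auto simp: closed_nbhd_def)

lemma closed_nbhd_increasing: "S \<subseteq> closed_nbhd G S"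
  by (simp add: closed_nbhd_def)

lemma (in pair_wf_digraph) closed_nbhd_subset_pverts:
  "S \<subseteq> pverts G \<Longrightarrow> closed_nbhd G S \<subseteq> pverts G"
  by (auto simp: closed_nbhd_def in_arcsD2)

lemma (in pair_wf_digraph) rabbit_territory_subset_pverts:
  "rabbit_territory G H i \<subseteq> pverts G"
proof (induction i)
  case (Suc i)
  then have "rabbit_territory G H i - set_mset (H ! i) \<subseteq> pverts G"
    by blast
  then show ?case
    by (simp add: closed_nbhd_subset_pverts)
qed simp

lemma card_set_mset_le_size: "card (set_mset M) \<le> size M"
  by (induction M) (auto simp: card_insert_if)

lemma mun_le_card_closed_nbhd:
  assumes "finite (pverts G)" "W \<subseteq> pverts G"
  shows "mun G (card W) \<le> card (closed_nbhd G W)"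
proof -
  have "finite {card (closed_nbhd G U) |U. U \<subseteq> pverts G \<and> card U = card W}"
    using assms(1) by simp
  then show ?thesis
    unfolding mun_def by (rule Min_le) (use assms(2) in blast)
qed

text \<open>A \<open>k\<close>-subset exists, so the minimum is attained by some \<open>W\<close>,
  and \<open>W \<subseteq> closed_nbhd G W \<subseteq> pverts G\<close> gives both bounds. The lower
  one later ensures that \<open>mun G k - k\<close> is not truncated.\<close>

lemma (in pair_fin_digraph) mun_bounds:
  assumes "k \<le> card (pverts G)"
  shows "k \<le> mun G k" "mun G k \<le> card (pverts G)"
proof -
  let ?A = "{card (closed_nbhd G W) |W. W \<subseteq> pverts G \<and> card W = k}"
  obtain U where "U \<subseteq> pverts G" "card U = k"
    using assms obtain_subset_with_card_n by metis
  then have "?A \<noteq> {}"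
    by blast
  moreover have "finite ?A"
    by simp
  ultimately have "mun G k \<in> ?A"
    unfolding mun_def by (intro Min_in)
  then obtain W where W: "W \<subseteq> pverts G" "card W = k" "mun G k = card (closed_nbhd G W)"
    by blast
  moreover have "closed_nbhd G W \<subseteq> pverts G"
    using W(1) by (rule closed_nbhd_subset_pverts)
  moreover have "W \<subseteq> closed_nbhd G W"
    by (rule closed_nbhd_increasing)
  ultimately show "k \<le> mun G k" "mun G k \<le> card (pverts G)"
    using W(2) card_mono[of "closed_nbhd G W" W] card_mono[of "pverts G" "closed_nbhd G W"]
    by (simp_all add: finite_subset[of _ "pverts G"])
qed

lemma rabbit_territory_append:
  "i \<le> length H \<Longrightarrow> rabbit_territory G (H @ H') i = rabbit_territory G H i"
  by (induction i) (simp_all add: nth_append)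

lemma (in pair_fin_digraph) rabbit_survives:
  assumes "1 \<le> k" "k \<le> card (pverts G)"
    and "\<And>M. M \<in> set H \<Longrightarrow> size M + k \<le> mun G k"
  shows "i \<le> length H \<Longrightarrow> mun G k \<le> card (rabbit_territory G H i)"
proof (induction i)
  case 0
  then show ?case
    using mun_bounds(2)[OF assms(2)] by simp
next
  case (Suc i)
  let ?R = "rabbit_territory G H i" and ?S = "set_mset (H ! i)"
  have "card ?S \<le> size (H ! i)"
    by (rule card_set_mset_le_size)
  moreover have "size (H ! i) + k \<le> mun G k"
    using Suc.prems by (intro assms(3)) simp
  moreover have "mun G k \<le> card ?R"
    using Suc by simp
  moreover have "card ?R - card ?S \<le> card (?R - ?S)"
    by (rule diff_card_le_card_Diff) simp
  ultimately have "k \<le> card (?R - ?S)"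
    by linarith
  \<comment> \<open>\<open>mun\<close> concerns sets of size exactly \<open>k\<close>, so the
    surviving positions are cut down to such a set; monotonicity of \<open>closed_nbhd\<close>
    carries the bound back.\<close>
  then obtain W where W: "W \<subseteq> ?R - ?S" "card W = k"
    using obtain_subset_with_card_n by metis
  have R: "?R \<subseteq> pverts G"
    by (rule rabbit_territory_subset_pverts)
  have "mun G k \<le> card (closed_nbhd G W)"
    using mun_le_card_closed_nbhd[of G W] W R by auto
  also have "\<dots> \<le> card (rabbit_territory G H (Suc i))"
  proof (rule card_mono)
    show "finite (rabbit_territory G H (Suc i))"
      using rabbit_territory_subset_pverts pair_finite_verts by (rule finite_subset)
    show "closed_nbhd G W \<subseteq> rabbit_territory G H (Suc i)"
      using closed_nbhd_mono[OF W(1)] by simp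
  qed
  finally show ?case .
qed

text \<open>Contrapositive of \<open>rabbit_survives\<close>: if no round exceeds
  \<open>mun G k - k\<close> shots, the territory never becomes empty. The additive form avoids
  truncated subtraction.\<close>

lemma (in pair_fin_digraph) winning_Max_size_gt:
  assumes "winning G H" "1 \<le> k" "k \<le> card (pverts G)"
  shows "mun G k < Max (size ` set H) + k"
proof (rule ccontr)
  assume *: "\<not> ?thesis"
  have "size M + k \<le> mun G k" if "M \<in> set H" for M
  proof -
    have "size M \<le> Max (size ` set H)"
      using that by (intro Max_ge) auto
    with * show ?thesis
      by linarith
  qed
  from rabbit_survives[OF assms(2,3) this]
  have "mun G k \<le> card (rabbit_territory G H i)" if "i \<le> length H" for i
    using that by blast
  \<comment> \<open>This is where \<open>1 \<le> k\<close> matters: a lower bound of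
    \<open>0\<close> would not exclude the empty territory.\<close>
  moreover have "0 < mun G k"
    using mun_bounds(1)[OF assms(3)] assms(2) by linarith
  ultimately show False
    using assms(1) unfolding winning_def by fastforce
qed

text \<open>Each round lowers the chain index by at least one until it reaches \<open>0\<close>, so
  one round per vertex suffices. The exact length also shows later that \<open>H\<close> is
  nonempty.\<close>

lemma (in pair_fin_digraph) nesting_winning_strategy:
  assumes "closed_isoperimetric_nesting G"
    and excess: "\<And>k. k \<in> {1..card (pverts G)} \<Longrightarrow> mun G k < k + h"
  shows "\<exists>H. winning G H \<and> length H = card (pverts G) \<and> (\<forall>M\<in>set H. size M \<le> h)"
proof -
  define n where "n = card (pverts G)"
  obtain C where C: "\<forall>i\<in>{1..n}. C i \<subseteq> pverts G \<and> card (C i) = i \<and>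
        card (closed_nbhd G (C i)) = mun G i \<and>
        closed_nbhd G (C i) = C (card (closed_nbhd G (C i)))"
    and C_chain: "\<forall>i\<in>{1..<n}. C i \<subset> C (Suc i)"
    using assms(1) unfolding closed_isoperimetric_nesting_def n_def by (elim exE conjE)
  \<comment> \<open>The given chain starts at index \<open>1\<close>; the empty set at index
    \<open>0\<close> adds the end of the game.\<close>
  define D where "D i = (if i = 0 then {} else C i)" for i
  have D_subset: "D i \<subseteq> pverts G" if "i \<le> n" for i
    using that C by (simp add: D_def)
  have D_card: "card (D i) = i" if "i \<le> n" for i
    using that C by (simp add: D_def)
  have D_mono: "j \<le> n \<Longrightarrow> D i \<subseteq> D j" if "i \<le> j" for i j
    using that
  proof (induction j rule: dec_induct)
    case (step j)
    then have "D j \<subseteq> D (Suc j)"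
      using C_chain by (auto simp: D_def)
    with step show ?case
      by simp
  qed simp
  \<comment> \<open>The bound \<open>n - t\<close> on the index forces the territory to be
    \<open>D 0\<close>, the empty set, at \<open>t = n\<close>.\<close>
  have "\<exists>H. hunter_strategy G H \<and> length H = t \<and> (\<forall>M\<in>set H. size M \<le> h)
          \<and> (\<exists>j\<le>n - t. rabbit_territory G H t = D j)" for t
  proof (induction t)
    case 0
    have "D n = pverts G"
      using D_subset[of n] D_card[of n] by (intro card_subset_eq) (auto simp: n_def)
    then show ?case
      by (intro exI[of _ "[]"]) (auto simp: hunter_strategy_def)
  next
    case (Suc t)
    then obtain H j where H: "hunter_strategy G H" "length H = t" "\<forall>M\<in>set H. size M \<le> h"
      and j: "j \<le> n - t" "rabbit_territory G H t = D j"
      by blast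
    \<comment> \<open>If \<open>j \<le> h\<close>, then \<open>j - h\<close> truncates to
      \<open>0\<close> and all of \<open>D j\<close> is shot.\<close>
    define S where "S = D j - D (j - h)"
    have le: "j \<le> n" "j - h \<le> n"
      using j(1) by auto
    have fin: "finite (D i)" if "i \<le> n" for i
      using D_subset[OF that] finite_subset pair_finite_verts by blast
    have sub: "D (j - h) \<subseteq> D j"
      using le by (intro D_mono) auto
    have S: "S \<subseteq> pverts G" "finite S"
      using D_subset[OF le(1)] fin[OF le(1)] by (auto simp: S_def)
    have "card S = j - (j - h)"
      unfolding S_def using sub fin le D_card by (simp add: card_Diff_subset)
    then have "size (mset_set S) \<le> h"
      by simp
    moreover have "hunter_strategy G (H @ [mset_set S])"
      using H(1) S by (auto simp: hunter_strategy_def)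
    moreover have "rabbit_territory G (H @ [mset_set S]) (Suc t) = closed_nbhd G (D (j - h))"
    proof -
      have "D j - S = D (j - h)"
        using sub by (auto simp: S_def)
      then show ?thesis
        using H(2) j(2) S(2) by (auto simp: rabbit_territory_append nth_append)
    qed
    moreover have "\<exists>l\<le>n - Suc t. closed_nbhd G (D (j - h)) = D l"
    proof (cases "j - h = 0")
      case True
      then show ?thesis
        by (auto simp: D_def)
    next
      case False
      let ?i = "j - h"
      have i: "?i \<in> {1..n}"
        using False le by simp
      have "mun G ?i < ?i + h" "?i \<le> mun G ?i"
        using i excess mun_bounds(1) by (auto simp: n_def)
      moreover have "mun G ?i \<noteq> 0"
        using False calculation(2) by linarith
      then have "D (mun G ?i) = C (mun G ?i)"
        by (simp add: D_def)
      moreover have "D ?i = C ?i"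
        using False by (simp add: D_def)
      moreover have "closed_nbhd G (C ?i) = C (mun G ?i)"
        using C i by metis
      ultimately have "mun G ?i < ?i + h" "closed_nbhd G (D ?i) = D (mun G ?i)"
        by simp_all
      \<comment> \<open>As \<open>j - h\<close> is positive, \<open>?i + h = j\<close>, so the new
        index \<open>mun G ?i\<close> is below \<open>j \<le> n - t\<close>.\<close>
      then show ?thesis
        using False j(1) by (intro exI[of _ "mun G ?i"]) auto
    qed
    ultimately show ?case
      using H(2,3) by (intro exI[of _ "H @ [mset_set S]"]) auto
  qed
  from this[of n] obtain H where H: "hunter_strategy G H" "length H = n"
    "\<forall>M\<in>set H. size M \<le> h" "rabbit_territory G H n = {}"
    by (auto simp: D_def)
  then have "winning G H"
    by (auto simp: winning_def)
  with H show ?thesis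
    by (auto simp: n_def)
qed

theorem theorem5p3:
  fixes G :: "'a pair_pre_digraph"
  assumes "pair_graph G"
    and "pverts G \<noteq> {}"
    and "closed_isoperimetric_nesting G"
  shows "int (Hun G) = 1 + Max {int (mun G k) - int k | k. k \<in> {1..card (pverts G)}}"
proof -
  interpret pair_graph G
    by (rule assms(1))
  let ?n = "card (pverts G)"
  let ?E = "{int (mun G k) - int k | k. k \<in> {1..?n}}"
  have n: "1 \<le> ?n"
    using assms(2) by (simp add: Suc_le_eq card_gt_0_iff)
  have E: "finite ?E" "?E \<noteq> {}"
    using n by auto
  then have "Max ?E \<in> ?E"
    by (rule Max_in)
  then obtain k where k: "k \<in> {1..?n}" and Max_eq: "Max ?E = int (mun G k) - int k"
    by blast
  \<comment> \<open>The optimal number of shots: one more than the excess at the maximizing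
    \<open>k\<close>.\<close>
  define h where "h = mun G k - k + 1"
  have h: "int h = 1 + Max ?E"
    using mun_bounds(1)[of k] k Max_eq by (simp add: h_def)
  have "mun G i < i + h" if "i \<in> {1..?n}" for i
  proof -
    have "int (mun G i) - int i \<le> Max ?E"
      using E(1) that by (intro Max_ge) auto
    with h show ?thesis
      by linarith
  qed
  then obtain H where H: "winning G H" "length H = ?n" "\<forall>M\<in>set H. size M \<le> h"
    using nesting_winning_strategy[OF assms(3)] by blast
  have "Hun G \<le> Max (size ` set H)"
    unfolding Hun_def using H(1) by (intro Least_le) blast
  \<comment> \<open>With at least one round, \<open>Max\<close> ranges over a nonempty set.\<close>
  also have "\<dots> \<le> h"
    using H(2,3) n by (subst Max_le_iff) auto
  finally have "Hun G \<le> h" .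
  \<comment> \<open>A winning strategy exists, so the least value is attained and the lower bound at
    \<open>k\<close> applies to \<open>Hun G\<close>.\<close>
  moreover have "\<exists>H. winning G H \<and> Hun G = Max (size ` set H)"
    unfolding Hun_def by (rule LeastI_ex) (use H(1) in blast)
  then have "mun G k < Hun G + k"
    using winning_Max_size_gt k by auto
  then have "h \<le> Hun G"
    using mun_bounds(1)[of k] k by (simp add: h_def)
  ultimately show ?thesis
    using h by simp
qed

end
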